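(* Let $P=\{p(y|x),\ x\in\mathcal{X},\ y\in\mathcal{Y}\}$ be a discrete memoryless channel with finite input alphabet $\mathcal{X}$ and finite output alphabet $\mathcal{Y}$. Then for every probability mass function $Q=\{q(x),\ x\in\mathcal{X}\}$ on $\mathcal{X}$ and every rate $R\ge 0$, $$\mathcal{E}_{CKM}(R,Q)\ \ge\ \mathcal{E}_G(R,Q),$$ where $$\mathcal{E}_G(R,Q)=\sup_{\rho\ge 1}\left\{-\rho\ln\left(\sum_{x,x'\in\mathcal{X}}q(x)q(x')\left[\sum_{y\in\mathcal{Y}}\sqrt{p(y|x)p(y|x')}\right]^{1/\rho}\right)-\rho R\right\}$$ is Gallager's expurgated exponent for the input assignment $Q$, and $$\mathcal{E}_{CKM}(R,Q)=\inf_{\hat{Q}_{XX'}\in\mathcal{A}(R,Q)}\left[I(X;X')+\boldsymbol{E}\,d_B(X,X')\right]-R$$ is the Csisz\'ar--K\"orner--Marton expurgated exponent for the input assignment $Q$.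
   Context: Here $\hat{Q}_{XX'}$ denotes a generic joint probability mass function on $\mathcal{X}\times\mathcal{X}$ of a pair of random variables $(X,X')$; both the mutual information $I(X;X')$ (in nats) and the expectation $\boldsymbol{E}$ are taken with respect to $\hat{Q}_{XX'}$. The constraint set is $$\mathcal{A}(R,Q)=\{\hat{Q}_{XX'}:\ \hat{Q}_X=\hat{Q}_{X'}=Q,\ I(X;X')\le R\},$$ where $\hat{Q}_X$ and $\hat{Q}_{X'}$ are the two marginals of $\hat{Q}_{XX'}$. The Bhattacharyya distance function is $$d_B(x,x')=-\ln\left[\sum_{y\in\mathcal{Y}}\sqrt{p(y|x)p(y|x')}\right],$$ with the convention $-\ln 0=+\infty$ (and $0\cdot\infty=0$ in expectations). The exponents may take the value $+\infty$. *)

theory Defs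
  imports "HOL-Probability.Probability"
begin

type_synonym ('x, 'y) dmc = "'x \<Rightarrow> 'y pmf"

definition bhattacharyya_coeff :: "('x, 'y::finite) dmc \<Rightarrow> 'x \<Rightarrow> 'x \<Rightarrow> real" where
  "bhattacharyya_coeff P x x' = (\<Sum>y\<in>UNIV. sqrt (pmf (P x) y * pmf (P x') y))"

text \<open>The case distinction is needed because \<^prop>\<open>ln (0::real) = 0\<close> in the library.\<close>

definition bhattacharyya_dist :: "('x, 'y::finite) dmc \<Rightarrow> 'x \<Rightarrow> 'x \<Rightarrow> ereal" where
  "bhattacharyya_dist P x x' =
     (if bhattacharyya_coeff P x x' = 0 then \<infinity> else ereal (- ln (bhattacharyya_coeff P x x')))"

text \<open>The expectation takes values in \<^typ>\<open>ereal\<close>, where \<^prop>\<open>(0::ereal) * \<infinity> = 0\<close>.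
  The summands are never negative (see \<open>bhattacharyya_dist_nonneg\<close> below).\<close>

definition expected_bhattacharyya_dist ::
    "('x::finite, 'y::finite) dmc \<Rightarrow> ('x \<times> 'x) pmf \<Rightarrow> ereal" where
  "expected_bhattacharyya_dist P J =
     (\<Sum>(x, x')\<in>UNIV. ereal (pmf J (x, x')) * bhattacharyya_dist P x x')"

text \<open>Logarithms to base \<^term>\<open>exp 1 :: real\<close>, i.e. information in nats.\<close>

definition mutual_info :: "('a \<times> 'b) pmf \<Rightarrow> real" where
  "mutual_info J = prob_space.mutual_information (measure_pmf J) (exp 1)
     (count_space UNIV) (count_space UNIV) fst snd"

definition admissible_joint :: "real \<Rightarrow> 'x pmf \<Rightarrow> ('x \<times> 'x) pmf set" where
  "admissible_joint R Q = {J. map_pmf fst J = Q \<and> map_pmf snd J = Q \<and> mutual_info J \<le> R}"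

definition gallager_exponent :: "('x::finite, 'y::finite) dmc \<Rightarrow> real \<Rightarrow> 'x pmf \<Rightarrow> ereal" where
  "gallager_exponent P R Q =
     (SUP \<rho>\<in>{1::real..}. ereal (- \<rho> * ln (\<Sum>x\<in>UNIV. \<Sum>x'\<in>UNIV.
        pmf Q x * pmf Q x' * bhattacharyya_coeff P x x' powr (1 / \<rho>)) - \<rho> * R))"

definition ckm_exponent :: "('x::finite, 'y::finite) dmc \<Rightarrow> real \<Rightarrow> 'x pmf \<Rightarrow> ereal" where
  "ckm_exponent P R Q =
     (INF J\<in>admissible_joint R Q. ereal (mutual_info J) + expected_bhattacharyya_dist P J) - ereal R"

lemma bhattacharyya_coeff_nonneg: "0 \<le> bhattacharyya_coeff P x x'"
  unfolding bhattacharyya_coeff_def by (intro sum_nonneg) auto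

lemma bhattacharyya_coeff_le_1: "bhattacharyya_coeff P x x' \<le> 1"
proof -
  have "bhattacharyya_coeff P x x' \<le> (\<Sum>y\<in>UNIV. (pmf (P x) y + pmf (P x') y) / 2)"
    unfolding bhattacharyya_coeff_def by (intro sum_mono arith_geo_mean_sqrt) auto
  also have "\<dots> = 1"
    by (simp add: sum_divide_distrib[symmetric] sum.distrib sum_pmf_eq_1)
  finally show ?thesis .
qed

lemma bhattacharyya_dist_nonneg: "0 \<le> bhattacharyya_dist P x x'"
  using bhattacharyya_coeff_nonneg[of P x x'] bhattacharyya_coeff_le_1[of P x x']
  by (simp add: bhattacharyya_dist_def)

lemma mutual_info_eq_sum:
  fixes J :: "('a::finite \<times> 'b::finite) pmf"
  shows "mutual_info J = (\<Sum>(x, y)\<in>UNIV. pmf J (x, y) *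
    ln (pmf J (x, y) / (pmf (map_pmf fst J) x * pmf (map_pmf snd J) y)))"
proof -
  interpret information_space "measure_pmf J" "exp 1"
    by unfold_locales auto
  have X: "simple_distributed (measure_pmf J) fst (pmf (map_pmf fst J))"
    by (rule measure_pmf.simple_distributedI) (auto simp: simple_function_def pmf_map)
  have Y: "simple_distributed (measure_pmf J) snd (pmf (map_pmf snd J))"
    by (rule measure_pmf.simple_distributedI) (auto simp: simple_function_def pmf_map)
  have XY: "simple_distributed (measure_pmf J) (\<lambda>z. (fst z, snd z)) (pmf J)"
    by (rule measure_pmf.simple_distributedI) (auto simp: simple_function_def pmf.rep_eq vimage_def)
  show ?thesis
    using mutual_information_simple_distributed[OF X Y XY]
    by (simp add: mutual_info_def log_def)
qed

end

(* Fix \<rho> \<ge> 1 and an admissible joint law J. Gibbs' inequality for J against the weights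
   q(x) q(x') b(x,x')^(1/\<rho>) bounds -\<rho> ln (\<dots>) by \<rho> I + E d_B, and
   \<rho> I + E d_B - \<rho> R = (I + E d_B - R) + (\<rho> - 1) (I - R), where the last summand is nonpositive. *)
theory Submission
  imports Defs
begin

text \<open>Nonnegativity of the relative entropy of \<open>J\<close> to \<open>w / S\<close>, with
  \<open>S\<close> the total of the weights, which need not be 1. Positivity on the support matters:
  with \<open>ln 0 = 0\<close>, a weight 0 there would contribute 0 instead of minus
  infinity.\<close>

lemma gibbs_inequality:
  fixes J :: "'a::finite pmf" and w :: "'a \<Rightarrow> real"
  assumes nonneg: "\<And>z. 0 \<le> w z" and pos: "\<And>z. pmf J z \<noteq> 0 \<Longrightarrow> 0 < w z"
  shows "(\<Sum>z\<in>UNIV. pmf J z * ln (w z / pmf J z)) \<le> ln (\<Sum>z\<in>UNIV. w z)"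
proof -
  define S where "S = (\<Sum>z\<in>UNIV. w z)"
  have J1: "(\<Sum>z\<in>UNIV. pmf J z) = 1"
    by (simp add: sum_pmf_eq_1)
  obtain z0 where "pmf J z0 \<noteq> 0"
    using set_pmf_not_empty[of J] by (auto simp: set_pmf_iff)
  then have S: "0 < S"
    unfolding S_def using nonneg pos by (intro sum_pos2[of _ z0]) auto
  \<comment> \<open>This is \<open>ln t \<le> t - 1\<close> at
    \<open>t = w z / (pmf J z * S)\<close>, times \<open>pmf J z\<close>. In the sum
    \<open>w z / S\<close> and \<open>pmf J z\<close> both total 1 and cancel, leaving
    \<open>ln S\<close>.\<close>
  have "pmf J z * ln (w z / pmf J z) \<le> w z / S - pmf J z + pmf J z * ln S" for z
  proof (cases "pmf J z = 0")
    case True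
    then show ?thesis
      using nonneg[of z] S by simp
  next
    case False
    then have J: "0 < pmf J z" and w: "0 < w z"
      using pos by (auto simp: order_less_le)
    have "ln (w z / pmf J z) - ln S = ln (w z / (pmf J z * S))"
      using J w S by (simp add: ln_div ln_mult)
    also have "\<dots> \<le> w z / (pmf J z * S) - 1"
      using J w S by (intro ln_le_minus_one) simp
    finally have "pmf J z * (ln (w z / pmf J z) - ln S) \<le> pmf J z * (w z / (pmf J z * S) - 1)"
      using J by (intro mult_left_mono) auto
    also have "\<dots> = w z / S - pmf J z"
      using J by (simp add: field_simps)
    finally show ?thesis
      by (simp add: algebra_simps)
  qed
  then have "(\<Sum>z\<in>UNIV. pmf J z * ln (w z / pmf J z))
      \<le> (\<Sum>z\<in>UNIV. w z / S - pmf J z + pmf J z * ln S)"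
    by (intro sum_mono)
  also have "\<dots> = ln S"
    using S J1 by (simp add: sum.distrib sum_subtractf sum_divide_distrib[symmetric]
        sum_distrib_right[symmetric] S_def[symmetric])
  finally show ?thesis
    unfolding S_def .
qed

lemma expected_bhattacharyya_dist_infinite:
  assumes "pmf J (x, x') \<noteq> 0" "bhattacharyya_coeff P x x' = 0"
  shows "expected_bhattacharyya_dist P J = \<infinity>"
proof -
  let ?f = "\<lambda>(x, x'). ereal (pmf J (x, x')) * bhattacharyya_dist P x x'"
  have "?f (x, x') = \<infinity>"
    using assms by (simp add: bhattacharyya_dist_def order_less_le)
  then show ?thesis
    unfolding expected_bhattacharyya_dist_def by (subst sum_Pinfty) (auto intro!: exI[of _ "(x, x')"])
qed

text \<open>Cells of mass 0 may have coefficient 0; there \<open>0 * \<infinity> = 0\<close> agrees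
  with the real product, so the sum can be taken in the reals.\<close>

lemma expected_bhattacharyya_dist_finite:
  assumes "\<And>x x'. pmf J (x, x') \<noteq> 0 \<Longrightarrow> bhattacharyya_coeff P x x' \<noteq> 0"
  shows "expected_bhattacharyya_dist P J =
    ereal (\<Sum>(x, x')\<in>UNIV. pmf J (x, x') * - ln (bhattacharyya_coeff P x x'))"
proof -
  have "ereal (pmf J (x, x')) * bhattacharyya_dist P x x' =
      ereal (pmf J (x, x') * - ln (bhattacharyya_coeff P x x'))" for x x'
    using assms[of x x'] by (cases "pmf J (x, x') = 0") (auto simp: bhattacharyya_dist_def)
  then show ?thesis
    unfolding expected_bhattacharyya_dist_def
    by (simp add: case_prod_unfold sum_ereal[symmetric] del: sum_ereal)
qed

lemma pmf_marginals_nonzero: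
  assumes "pmf J (x, y) \<noteq> 0"
  shows "pmf (map_pmf fst J) x \<noteq> 0" "pmf (map_pmf snd J) y \<noteq> 0"
  using assms by (auto simp: set_pmf_iff[symmetric] image_iff intro: bexI[of _ "(x, y)"])

text \<open>\<open>ereal R\<close> stands on the left so that the bound passes directly to the
  infimum over \<open>J\<close>.\<close>

lemma gallager_term_le:
  fixes P :: "('x::finite, 'y::finite) dmc"
  assumes J: "J \<in> admissible_joint R Q" and \<rho>: "1 \<le> \<rho>"
  shows "ereal (- \<rho> * ln (\<Sum>x\<in>UNIV. \<Sum>x'\<in>UNIV.
      pmf Q x * pmf Q x' * bhattacharyya_coeff P x x' powr (1 / \<rho>)) - \<rho> * R) + ereal R
    \<le> ereal (mutual_info J) + expected_bhattacharyya_dist P J"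
\<comment> \<open>If \<open>J\<close> charges a pair with coefficient 0, the right side is infinite;
  otherwise everything is real.\<close>
proof (cases "\<exists>x x'. pmf J (x, x') \<noteq> 0 \<and> bhattacharyya_coeff P x x' = 0")
  case True
  then show ?thesis
    using expected_bhattacharyya_dist_infinite[of J _ _ P] by (elim exE conjE) simp
next
  case False
  define b where "b z = bhattacharyya_coeff P (fst z) (snd z)" for z
  define q where "q z = pmf Q (fst z) * pmf Q (snd z)" for z
  define w where "w z = q z * b z powr (1 / \<rho>)" for z
  define D where "D = (\<Sum>z\<in>UNIV. pmf J z * - ln (b z))"
  have marg: "map_pmf fst J = Q" "map_pmf snd J = Q" and I: "mutual_info J \<le> R"
    using J by (auto simp: admissible_joint_def)
  have b: "0 < b z" and q: "0 < q z" if "pmf J z \<noteq> 0" for z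
  proof -
    show "0 < b z"
      using False that bhattacharyya_coeff_nonneg[of P "fst z" "snd z"]
      by (cases z) (auto simp: b_def order_less_le)
    show "0 < q z"
      using pmf_marginals_nonzero[of J "fst z" "snd z"] that marg
      by (auto simp: q_def order_less_le)
  qed
  have D: "expected_bhattacharyya_dist P J = ereal D"
    using False by (subst expected_bhattacharyya_dist_finite)
      (auto simp: D_def b_def case_prod_unfold)
  have S: "(\<Sum>x\<in>UNIV. \<Sum>x'\<in>UNIV. pmf Q x * pmf Q x' *
      bhattacharyya_coeff P x x' powr (1 / \<rho>)) = (\<Sum>z\<in>UNIV. w z)"
    by (simp add: sum.cartesian_product w_def q_def b_def case_prod_unfold)
  \<comment> \<open>On the support of \<open>J\<close> the logarithm splits into
    \<open>- ln (pmf J z / q z)\<close> and \<open>ln (b z) / \<rho>\<close>. Since \<open>q\<close>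
    is the product of the marginals of \<open>J\<close>, the first part sums to minus the mutual
    information.\<close>
  have "- mutual_info J - D / \<rho> = (\<Sum>z\<in>UNIV. pmf J z * ln (w z / pmf J z))"
  proof -
    have "pmf J z * ln (w z / pmf J z) =
        - (pmf J z * ln (pmf J z / q z)) - pmf J z * - ln (b z) / \<rho>" for z
    proof (cases "pmf J z = 0")
      case nz: False
      then have "0 < pmf J z"
        by (simp add: order_less_le)
      then show ?thesis
        using b[OF nz] q[OF nz] by (simp add: w_def ln_div ln_mult ln_powr field_simps)
    qed simp
    then show ?thesis
      by (simp add: mutual_info_eq_sum marg D_def q_def case_prod_unfold sum_subtractf
          sum_negf sum_divide_distrib)
  qed
  also have "\<dots> \<le> ln (\<Sum>z\<in>UNIV. w z)"
    using b q by (intro gibbs_inequality) (fastforce simp: w_def q_def)+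
  finally have "\<rho> * (- mutual_info J - D / \<rho>) \<le> \<rho> * ln (\<Sum>z\<in>UNIV. w z)"
    using \<rho> by (intro mult_left_mono) auto
  then have "- \<rho> * ln (\<Sum>z\<in>UNIV. w z) \<le> \<rho> * mutual_info J + D"
    using \<rho> by (simp add: algebra_simps)
  \<comment> \<open>The rate constraint replaces all but one of the \<rho> copies of the mutual
    information by \<open>R\<close>.\<close>
  moreover have "(\<rho> - 1) * mutual_info J \<le> (\<rho> - 1) * R"
    using \<rho> I by (intro mult_left_mono) auto
  ultimately have "- \<rho> * ln (\<Sum>z\<in>UNIV. w z) - \<rho> * R + R \<le> mutual_info J + D"
    by (simp add: algebra_simps)
  then show ?thesis
    unfolding S D by simp
qed

theorem mainTheorem2:
  fixes P :: "('x::finite, 'y::finite) dmc" and Q :: "'x pmf" and R :: real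
  assumes "R \<ge> 0"
  shows "ckm_exponent P R Q \<ge> gallager_exponent P R Q"
  unfolding gallager_exponent_def
proof (rule SUP_least)
  fix \<rho> :: real
  assume "\<rho> \<in> {1..}"
  then show "ereal (- \<rho> * ln (\<Sum>x\<in>UNIV. \<Sum>x'\<in>UNIV.
      pmf Q x * pmf Q x' * bhattacharyya_coeff P x x' powr (1 / \<rho>)) - \<rho> * R)
    \<le> ckm_exponent P R Q"
    \<comment> \<open>As \<open>ereal R\<close> is finite, it moves across the inequality and the
      side conditions for infinite values are vacuous.\<close>
    unfolding ckm_exponent_def ereal_le_minus_iff
    by (intro conjI impI INF_greatest gallager_term_le) simp_all
qed

end
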